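(* Let $p$ be an odd prime, $q\in\mathbb{C}_p$ with $|1-q|_p<p^{-1/(p-1)}$, and $\alpha\in\mathbb{N}$. Then $\widetilde{\beta}_{0,q}^{(\alpha)}=1$, and for $n\in\mathbb{Z}_+$ with $n\ge1$, $$q\widetilde{\beta}_{n,q}^{(\alpha)}(1)-\widetilde{\beta}_{n,q}^{(\alpha)}=\begin{cases}\dfrac{\alpha}{[\alpha]_q}, & n=1,\\[2mm] 0, & n>1.\end{cases}$$
   Context: $q^x=\exp(x\log q)$ for $x\in\mathbb{Z}_p$; $[x]_q=\frac{1-q^x}{1-q}$, $[\alpha]_q=\frac{1-q^\alpha}{1-q}$, $[x]_{q^\alpha}=\frac{1-q^{\alpha x}}{1-q^\alpha}$. For uniformly differentiable $f:\mathbb{Z}_p\to\mathbb{C}_p$, $\int_{\mathbb{Z}_p}f(y)\,d\mu_q(y)=\lim_{N\to\infty}\frac{1}{[p^N]_q}\sum_{y=0}^{p^N-1}f(y)q^y$. Define $\widetilde{\beta}_{n,q}^{(\alpha)}(x)=\int_{\mathbb{Z}_p}[x+y]_{q^\alpha}^n\,d\mu_q(y)$ for $x\in\mathbb{Z}_p$, and $\widetilde{\beta}_{n,q}^{(\alpha)}=\widetilde{\beta}_{n,q}^{(\alpha)}(0)$. *)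

theory Defs
  imports "HOL-Analysis.Analysis" "HOL-Computational_Algebra.Computational_Algebra"
begin

text \<open>The library constant \<^const>\<open>norm\<close> is constrained to real normed vector spaces.\<close>

class nonarch_normed_field = field_char_0 + metric_space +
  fixes padic_norm :: "'a \<Rightarrow> real"
  assumes dist_padic_norm: "dist x y = padic_norm (x - y)"
    and padic_norm_mult: "padic_norm (x * y) = padic_norm x * padic_norm y"
    and padic_norm_add: "padic_norm (x + y) \<le> max (padic_norm x) (padic_norm y)"

text \<open>
  If the norm of a prime \<open>p\<close> is \<open>1/p\<close>, then the norm restricts to the \<open>p\<close>-adic absolute value on
  the rational numbers. In a complete field the closure of the rational numbers is then their
  \<open>p\<close>-adic completion.
\<close>

definition padic_rationals :: "'a::nonarch_normed_field set" where
  "padic_rationals = closure (range of_rat)"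

definition padic_integers :: "'a::nonarch_normed_field set" where
  "padic_integers = {x \<in> padic_rationals. padic_norm x \<le> 1}"

definition padic_algebraic :: "'a::nonarch_normed_field set" where
  "padic_algebraic =
     {x. \<exists>f. f \<noteq> 0 \<and> (\<forall>i. coeff f i \<in> padic_rationals) \<and> poly f x = 0}"

text \<open>
  The type \<open>'a\<close> is the completion of an algebraic closure of the \<open>p\<close>-adic numbers. This determines
  \<open>'a\<close> up to isometric isomorphism. The last two conjuncts say that \<open>'a\<close> is the completion of
  \<^const>\<open>padic_algebraic\<close>, the one before that this subfield is algebraically closed.
\<close>

definition is_padic_complex_field :: "nat \<Rightarrow> 'a::nonarch_normed_field itself \<Rightarrow> bool" where
  "is_padic_complex_field p _ \<longleftrightarrow>
     prime p \<and>
     padic_norm (of_nat p :: 'a) = 1 / real p \<and>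
     (\<forall>f :: 'a poly. degree f > 0 \<longrightarrow> (\<forall>i. coeff f i \<in> padic_algebraic) \<longrightarrow>
        (\<exists>x \<in> padic_algebraic. poly f x = 0)) \<and>
     closure (padic_algebraic :: 'a set) = UNIV \<and>
     complete (UNIV :: 'a set)"

definition padic_exp :: "'a::nonarch_normed_field \<Rightarrow> 'a" where
  "padic_exp x = (\<Sum>n. x ^ n / fact n)"

definition padic_log :: "'a::nonarch_normed_field \<Rightarrow> 'a" where
  "padic_log x = (\<Sum>n. (- 1) ^ n * (x - 1) ^ Suc n / of_nat (Suc n))"

text \<open>The exponent \<open>x\<close> is meant to range over \<^const>\<open>padic_integers\<close>.\<close>

definition padic_pow :: "'a::nonarch_normed_field \<Rightarrow> 'a \<Rightarrow> 'a" where
  "padic_pow q x = padic_exp (x * padic_log q)"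

text \<open>
  The \<open>q\<close>-number of \<open>x\<close> to the base \<open>q ^ \<alpha>\<close>. For \<open>\<alpha> > 0\<close> and \<open>q\<close> at distance
  less than \<open>p powr (- 1 / (p - 1))\<close> from \<open>1\<close>, the first case is just \<open>q = 1\<close>, where the
  quotient would be \<open>0 / 0\<close> and is replaced by its limit.
\<close>

definition q_number_base :: "nat \<Rightarrow> 'a::nonarch_normed_field \<Rightarrow> 'a \<Rightarrow> 'a" where
  "q_number_base \<alpha> q x =
     (if q ^ \<alpha> = 1 then x else (1 - padic_pow q (of_nat \<alpha> * x)) / (1 - q ^ \<alpha>))"

abbreviation q_number :: "'a::nonarch_normed_field \<Rightarrow> 'a \<Rightarrow> 'a" where
  "q_number \<equiv> q_number_base 1"

text \<open>
  The \<open>p\<close>-adic \<open>q\<close>-integral over the \<open>p\<close>-adic integers; the values of \<open>f\<close> outside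
  \<^const>\<open>padic_integers\<close> play no role.
\<close>

definition q_integral ::
  "nat \<Rightarrow> 'a::nonarch_normed_field \<Rightarrow> ('a \<Rightarrow> 'a) \<Rightarrow> 'a" where
  "q_integral p q f =
     lim (\<lambda>N. 1 / q_number q (of_nat (p ^ N)) * (\<Sum>y<p ^ N. f (of_nat y) * q ^ y))"

definition q_bernoulli_poly ::
  "nat \<Rightarrow> nat \<Rightarrow> nat \<Rightarrow> 'a::nonarch_normed_field \<Rightarrow> 'a \<Rightarrow> 'a" where
  "q_bernoulli_poly p \<alpha> n q x = q_integral p q (\<lambda>y. q_number_base \<alpha> q (x + y) ^ n)"

definition q_bernoulli_number ::
  "nat \<Rightarrow> nat \<Rightarrow> nat \<Rightarrow> 'a::nonarch_normed_field \<Rightarrow> 'a" where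
  "q_bernoulli_number p \<alpha> n q = q_bernoulli_poly p \<alpha> n q 0"

end

theory Submission imports Defs begin

text \<open>
  Once \<open>exp (n log q) = q ^ n\<close> is known, every \<open>q\<close>-number in the approximating sums is a finite
  geometric sum \<open>[m] = \<Sum>i<m. r ^ i\<close> with \<open>r = q\<close> or \<open>r = q ^ \<alpha>\<close>, also when \<open>q = 1\<close>, and
  has the same norm as \<open>m\<close>. For \<open>n \<ge> 1\<close> the difference in the theorem telescopes at level \<open>N\<close>
  to a boundary term, which tends to the claimed value because
  \<open>[p ^ N]\<close> to base \<open>q ^ \<alpha>\<close> over \<open>[p ^ N]\<close> to base \<open>q\<close> equals
  \<open>(\<Sum>i<\<alpha>. q ^ (i * p ^ N)) / [\<alpha>]\<close>. Expanding \<open>[1 + y] = 1 + q ^ \<alpha> [y]\<close> turns the same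
  identity into a recurrence in \<open>n\<close> for the approximating sums, and this gives their convergence.
\<close>

subsection \<open>Non-archimedean norms and series\<close>

lemma padic_norm_nonneg [simp]: "0 \<le> padic_norm x"
  by (metis diff_zero dist_padic_norm zero_le_dist)

lemma padic_norm_eq_0_iff [simp]: "padic_norm x = 0 \<longleftrightarrow> x = 0"
  by (metis diff_zero dist_eq_0_iff dist_padic_norm)

lemma padic_norm_pos_iff [simp]: "0 < padic_norm x \<longleftrightarrow> x \<noteq> 0"
  by (simp add: order.strict_iff_order eq_commute[of 0])

lemma padic_norm_0 [simp]: "padic_norm 0 = 0"
  by simp

lemma padic_norm_minus_commute: "padic_norm (x - y) = padic_norm (y - x)"
  by (metis dist_commute dist_padic_norm)

lemma padic_norm_minus [simp]: "padic_norm (- x) = padic_norm x"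
  by (metis diff_0 diff_zero padic_norm_minus_commute)

lemma padic_norm_1 [simp]: "padic_norm 1 = 1"
  by (metis mult_cancel_left1 mult.left_neutral padic_norm_eq_0_iff padic_norm_mult zero_neq_one)

lemma padic_norm_power: "padic_norm (x ^ n) = padic_norm x ^ n"
  by (induction n) (simp_all add: padic_norm_mult)

lemma padic_norm_inverse: "padic_norm (inverse x) = inverse (padic_norm x)"
proof (cases "x = 0")
  case False
  then have "padic_norm x * padic_norm (inverse x) = 1"
    by (simp flip: padic_norm_mult)
  then show ?thesis
    by (metis inverse_unique)
qed simp

lemma padic_norm_divide: "padic_norm (x / y) = padic_norm x / padic_norm y"
  by (simp add: divide_inverse padic_norm_mult padic_norm_inverse)

lemma padic_norm_add_le: "padic_norm x \<le> B \<Longrightarrow> padic_norm y \<le> B \<Longrightarrow> padic_norm (x + y) \<le> B"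
  using padic_norm_add[of x y] by simp

lemma padic_norm_diff_le: "padic_norm x \<le> B \<Longrightarrow> padic_norm y \<le> B \<Longrightarrow> padic_norm (x - y) \<le> B"
  using padic_norm_add_le[of x B "- y"] by simp

text \<open>The isosceles principle: writing \<open>y\<close> as \<open>(x + y) - x\<close> bounds
  its norm by the larger of the norms of \<open>x + y\<close> and \<open>x\<close>, and the latter
  is too small.\<close>

lemma padic_norm_add_eq_right:
  assumes "padic_norm x < padic_norm y"
  shows "padic_norm (x + y) = padic_norm y"
proof (rule antisym)
  show "padic_norm (x + y) \<le> padic_norm y"
    using assms by (intro padic_norm_add_le) auto
  show "padic_norm y \<le> padic_norm (x + y)"
    using padic_norm_add[of "x + y" "- x"] assms by (auto simp: max_def split: if_splits)
qed

lemma padic_norm_sum_le: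
  assumes "\<And>i. i \<in> A \<Longrightarrow> padic_norm (f i) \<le> B" "0 \<le> B"
  shows "padic_norm (sum f A) \<le> B"
  using assms by (induction A rule: infinite_finite_induct) (auto intro: padic_norm_add_le)

lemma padic_norm_of_nat_le_1: "padic_norm (of_nat n) \<le> 1"
  by (induction n) (auto intro: padic_norm_add_le)

lemma tendsto_padic_norm_iff:
  "(f \<longlongrightarrow> l) F \<longleftrightarrow> ((\<lambda>x. padic_norm (f x - l)) \<longlongrightarrow> 0) F"
  by (subst tendsto_dist_iff) (simp add: dist_padic_norm)

lemma tendsto_0_padic_norm_le:
  assumes "(g \<longlongrightarrow> 0) F" "\<And>x. padic_norm (f x - l) \<le> g x"
  shows "(f \<longlongrightarrow> l) F"
  unfolding tendsto_padic_norm_iff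
  by (rule tendsto_sandwich[OF _ _ tendsto_const assms(1)]) (auto simp: assms(2))

section \<open>Continuity of addition, negation and multiplication\<close>

instance nonarch_normed_field \<subseteq> topological_ab_group_add
proof
  fix a b :: 'a
  show "((\<lambda>x. fst x + snd x) \<longlongrightarrow> a + b) (nhds a \<times>\<^sub>F nhds b)"
  proof -
    have 1: "((\<lambda>x. padic_norm (fst x - a)) \<longlongrightarrow> 0) (nhds a \<times>\<^sub>F nhds b)"
      using filterlim_fst[of "nhds a" "nhds b"] by (simp add: tendsto_padic_norm_iff)
    have 2: "((\<lambda>x. padic_norm (snd x - b)) \<longlongrightarrow> 0) (nhds a \<times>\<^sub>F nhds b)"
      using filterlim_snd[of "nhds b" "nhds a"] by (simp add: tendsto_padic_norm_iff)
    show ?thesis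
    proof (rule tendsto_0_padic_norm_le)
      show "((\<lambda>x. padic_norm (fst x - a) + padic_norm (snd x - b)) \<longlongrightarrow> 0) (nhds a \<times>\<^sub>F nhds b)"
        using tendsto_add[OF 1 2] by simp
      show "padic_norm (fst x + snd x - (a + b)) \<le> padic_norm (fst x - a) + padic_norm (snd x - b)" for x
        using padic_norm_add[of "fst x - a" "snd x - b"]
          padic_norm_nonneg[of "fst x - a"] padic_norm_nonneg[of "snd x - b"]
        by (simp add: add_diff_add del: padic_norm_nonneg)
    qed
  qed
  show "(uminus \<longlongrightarrow> - a) (nhds a)"
    using filterlim_ident[of "nhds a"]
    by (simp add: tendsto_padic_norm_iff padic_norm_minus_commute)
qed

instance nonarch_normed_field \<subseteq> topological_semigroup_mult
proof
  fix a b :: 'a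
  show "((\<lambda>x. fst x * snd x) \<longlongrightarrow> a * b) (nhds a \<times>\<^sub>F nhds b)"
  proof -
    let ?u = "\<lambda>x. padic_norm (fst x - a)" and ?v = "\<lambda>x. padic_norm (snd x - b)"
    have 1: "(?u \<longlongrightarrow> 0) (nhds a \<times>\<^sub>F nhds b)"
      using filterlim_fst[of "nhds a" "nhds b"] by (simp add: tendsto_padic_norm_iff)
    have 2: "(?v \<longlongrightarrow> 0) (nhds a \<times>\<^sub>F nhds b)"
      using filterlim_snd[of "nhds b" "nhds a"] by (simp add: tendsto_padic_norm_iff)
    show ?thesis
    proof (rule tendsto_0_padic_norm_le)
      show "((\<lambda>x. ?u x * ?v x + padic_norm a * ?v x + ?u x * padic_norm b) \<longlongrightarrow> 0) (nhds a \<times>\<^sub>F nhds b)"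
        using tendsto_add[OF tendsto_add[OF tendsto_mult[OF 1 2] tendsto_mult[OF tendsto_const 2]]
            tendsto_mult[OF 1 tendsto_const]] by simp
      show "padic_norm (fst x * snd x - a * b) \<le> ?u x * ?v x + padic_norm a * ?v x + ?u x * padic_norm b" for x
      proof -
        have "fst x * snd x - a * b
            = (fst x - a) * (snd x - b) + (a * (snd x - b) + (fst x - a) * b)"
          by (simp add: algebra_simps)
        also have "padic_norm \<dots> \<le> ?u x * ?v x + (padic_norm a * ?v x + ?u x * padic_norm b)"
          unfolding padic_norm_mult[symmetric]
          by (intro order_trans[OF padic_norm_add] padic_norm_add_le max.boundedI) (auto intro: add_increasing add_increasing2)
        finally show ?thesis by (simp add: add.assoc)
      qed
    qed
  qed
qed

text \<open>A partial sum closer to \<open>s\<close> than the norm of \<open>s\<close> has the same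
  norm as \<open>s\<close> by the isosceles principle, so the bound on partial sums passes to the
  limit.\<close>

lemma padic_norm_sums_le:
  assumes "f sums s" "\<And>i. padic_norm (f i) \<le> B" "0 \<le> B"
  shows "padic_norm s \<le> B"
proof (rule ccontr)
  assume "\<not> padic_norm s \<le> B"
  then have gt: "padic_norm s > B" and "padic_norm s > 0"
    using assms(3) by auto
  moreover have "(\<lambda>n. padic_norm ((\<Sum>i<n. f i) - s)) \<longlonglongrightarrow> 0"
    using assms(1) unfolding sums_def by (simp add: tendsto_padic_norm_iff[symmetric])
  ultimately have "eventually (\<lambda>n. padic_norm ((\<Sum>i<n. f i) - s) < padic_norm s) sequentially"
    by (intro order_tendstoD)
  then obtain n where n: "padic_norm ((\<Sum>i<n. f i) - s) < padic_norm s"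
    by (auto simp: eventually_sequentially)
  then have "padic_norm (\<Sum>i<n. f i) = padic_norm s"
    using padic_norm_add_eq_right by force
  moreover have "padic_norm (\<Sum>i<n. f i) \<le> B"
    using assms(2,3) by (rule padic_norm_sum_le)
  ultimately show False
    using gt by simp
qed

text \<open>By the ultrametric inequality a block of consecutive terms is no larger than a bound on
  each of them, so null terms already make the partial sums Cauchy.\<close>

lemma nonarch_summable:
  fixes f :: "nat \<Rightarrow> 'a::nonarch_normed_field"
  assumes "complete (UNIV :: 'a set)" "f \<longlonglongrightarrow> 0"
  shows "summable f"
proof -
  have "Cauchy (\<lambda>n. \<Sum>i<n. f i)"
  proof (rule metric_CauchyI)
    fix e :: real assume "e > 0"
    then obtain M where M: "\<And>n. n \<ge> M \<Longrightarrow> padic_norm (f n) \<le> e / 2"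
      using assms(2) unfolding tendsto_padic_norm_iff lim_sequentially
      by (metis diff_zero dist_real_def half_gt_zero less_imp_le abs_of_nonneg padic_norm_nonneg)
    have *: "dist (\<Sum>i<n. f i) (\<Sum>i<m. f i) < e" if "M \<le> m" "m \<le> n" for m n
    proof -
      have "(\<Sum>i<n. f i) - (\<Sum>i<m. f i) = sum f {m..<n}"
        using \<open>m \<le> n\<close> by (metis atLeast0LessThan sum_diff_nat_ivl zero_le)
      moreover have "padic_norm (sum f {m..<n}) \<le> e / 2"
        using M that \<open>e > 0\<close> by (intro padic_norm_sum_le) auto
      ultimately show ?thesis
        using \<open>e > 0\<close> by (simp add: dist_padic_norm)
    qed
    show "\<exists>M. \<forall>m\<ge>M. \<forall>n\<ge>M. dist (\<Sum>i<m. f i) (\<Sum>i<n. f i) < e"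
      using * by (metis dist_commute nle_le)
  qed
  then show ?thesis
    using assms(1) by (auto simp: complete_def summable_def sums_def)
qed


instance nonarch_normed_field \<subseteq> topological_comm_monoid_mult
  by standard

lemma sums_tail:
  fixes f :: "nat \<Rightarrow> 'a::{topological_ab_group_add,t2_space}"
  assumes "f sums s"
  shows "(\<lambda>i. f (i + n)) sums (s - (\<Sum>i<n. f i))"
proof -
  have "(\<lambda>m. (\<Sum>i<m + n. f i) - (\<Sum>i<n. f i)) \<longlonglongrightarrow> s - (\<Sum>i<n. f i)"
    using LIMSEQ_ignore_initial_segment[OF assms[unfolded sums_def], of n]
    by (intro tendsto_diff tendsto_const)
  moreover have "(\<Sum>i<m + n. f i) - (\<Sum>i<n. f i) = (\<Sum>i<m. f (i + n))" for m
    by (induction m) (auto simp: algebra_simps)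
  ultimately show ?thesis
    by (simp add: sums_def)
qed

section \<open>Norms of integers and factorials\<close>

locale padic_field =
  fixes p :: nat and ty :: "'a::nonarch_normed_field itself"
  assumes prime_p: "prime p"
    and norm_p: "padic_norm (of_nat p :: 'a) = 1 / real p"
    and complete_UNIV: "complete (UNIV :: 'a set)"
begin

lemma p_gt_1: "p > 1"
  using prime_p by (rule prime_gt_1_nat)

text \<open>Bezout gives \<open>m * a = p * b + 1\<close>, which has norm 1 because
  \<open>p * b\<close> has norm below 1. Both factors on the left have norm at most 1, hence exactly
  1.\<close>

lemma norm_of_nat_not_dvd:
  assumes "\<not> p dvd m"
  shows "padic_norm (of_nat m :: 'a) = 1"
proof -
  have "gcd m p = 1"
    using prime_imp_coprime[OF prime_p assms] by (simp add: coprime_iff_gcd_eq_1 gcd.commute)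
  moreover have "m \<noteq> 0"
    using assms by (metis dvd_0_right)
  ultimately obtain a b where ab: "m * a = p * b + 1"
    using bezout_nat[of m p] by auto
  have "padic_norm (of_nat (p * b) :: 'a) < padic_norm (1 :: 'a)"
    using p_gt_1 norm_p padic_norm_of_nat_le_1[of b, where 'a = 'a]
      mult_left_le[of "padic_norm (of_nat b :: 'a)" "padic_norm (of_nat p :: 'a)"]
    by (simp add: padic_norm_mult order.strict_trans1)
  then have "padic_norm (of_nat (p * b + 1) :: 'a) = 1"
    by (metis of_nat_1 of_nat_add padic_norm_1 padic_norm_add_eq_right)
  then have "padic_norm (of_nat m :: 'a) * padic_norm (of_nat a :: 'a) = 1"
    by (metis ab of_nat_mult padic_norm_mult)
  then show ?thesis
    using padic_norm_of_nat_le_1[of m, where 'a = 'a] padic_norm_of_nat_le_1[of a, where 'a = 'a]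
    by (metis mult_left_le order_antisym padic_norm_nonneg)
qed

lemma norm_fact_less: "k < p \<Longrightarrow> padic_norm (fact (p * m + k) :: 'a) = padic_norm (fact (p * m) :: 'a)"
proof (induction k)
  case (Suc k)
  have "\<not> p dvd Suc (p * m + k)"
    using Suc.prems by (metis add_Suc_right dvd_add_right_iff dvd_triv_left nat_dvd_not_less zero_less_Suc)
  then have "padic_norm (of_nat (Suc (p * m + k)) :: 'a) = 1"
    by (rule norm_of_nat_not_dvd)
  then show ?case
    using Suc by (simp add: padic_norm_mult del: of_nat_Suc)
qed simp

text \<open>Each block of \<open>p\<close> consecutive factors contains one multiple of
  \<open>p\<close>, and only this one affects the norm. The multiples together give
  \<open>p ^ m * fact m\<close>.\<close>

lemma norm_fact_mult: "padic_norm (fact (p * m) :: 'a) = (1 / real p) ^ m * padic_norm (fact m :: 'a)"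
proof (induction m)
  case (Suc m)
  have eq: "p * Suc m = Suc (p * m + (p - 1))"
    using p_gt_1 by simp
  have "(fact (p * Suc m) :: 'a) = of_nat (p * Suc m) * fact (p * m + (p - 1))"
    unfolding eq fact_Suc by (rule refl)
  moreover have "padic_norm (fact (p * m + (p - 1)) :: 'a) = padic_norm (fact (p * m) :: 'a)"
    using p_gt_1 by (intro norm_fact_less) auto
  ultimately show ?case
    using Suc by (simp add: padic_norm_mult norm_p del: of_nat_Suc mult_Suc_right)
qed simp

subsection \<open>The exponential function\<close>

text \<open>The radius of convergence of the exponential series, the positive real whose power
  \<open>p - 1\<close> is the norm of \<open>p\<close>.\<close>

definition radius :: real where
  "radius = real p powr (- 1 / (real p - 1))"

lemma radius_pos: "radius > 0"
  using p_gt_1 by (simp add: radius_def)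

lemma radius_power: "radius ^ (p - 1) = 1 / real p"
proof -
  have "radius ^ (p - 1) = real p powr (- 1 / (real p - 1) * real (p - 1))"
    using p_gt_1 unfolding radius_def by (simp add: powr_power)
  also have "- 1 / (real p - 1) * real (p - 1) = - 1"
    using p_gt_1 by (simp add: of_nat_diff)
  finally show ?thesis
    using p_gt_1 by (simp add: powr_minus_divide)
qed

lemma radius_less_1: "radius < 1"
  using p_gt_1 by (simp add: radius_def powr_less_one)

text \<open>A weak form of Legendre's formula. Induction along \<open>j div p\<close> replaces the
  digit sum of \<open>j\<close>; at \<open>j = 0\<close> the exponent is truncated to 0.\<close>

lemma norm_fact_ge: "radius ^ (j - 1) \<le> padic_norm (fact j :: 'a)"
proof (induction j rule: less_induct)
  case (less j)
  define m k where "m = j div p" and "k = j mod p"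
  have j: "j = p * m + k" and k: "k < p"
    using p_gt_1 by (auto simp: m_def k_def)
  have norm: "padic_norm (fact j :: 'a) = radius ^ ((p - 1) * m) * padic_norm (fact m :: 'a)"
    unfolding j norm_fact_less[OF k] norm_fact_mult by (simp add: power_mult radius_power del: One_nat_def)
  show ?case
  proof (cases "m = 0")
    case True
    then show ?thesis
      using norm radius_pos radius_less_1 by (simp add: power_le_one)
  next
    case False
    then have "m < j"
      using p_gt_1 unfolding m_def by (metis bot_nat_0.not_eq_extremum div_0 div_less_dividend)
    \<comment> \<open>As \<open>m\<close> is positive, the left side is
      \<open>p * m - 1\<close>.\<close>
    have "(p - 1) * m + (m - 1) \<le> j - 1"
      using False p_gt_1 j by (simp add: algebra_simps)
    then have "radius ^ (j - 1) \<le> radius ^ ((p - 1) * m + (m - 1))"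
      using radius_pos radius_less_1 by (intro power_decreasing) auto
    also have "\<dots> \<le> padic_norm (fact j :: 'a)"
      unfolding norm power_add using less.IH[OF \<open>m < j\<close>] radius_pos by (intro mult_left_mono) auto
    finally show ?thesis .
  qed
qed

text \<open>Lets bounds for exponential terms serve also for series with denominators
  \<open>j\<close>, such as the logarithm.\<close>

lemma norm_fact_le_of_nat:
  assumes "0 < j"
  shows "padic_norm (fact j :: 'a) \<le> padic_norm (of_nat j :: 'a)"
proof -
  have "padic_norm (fact n :: 'a) \<le> 1" for n
    using padic_norm_of_nat_le_1[of "fact n", where 'a = 'a] by simp
  then show ?thesis
    using assms by (cases j) (auto simp: padic_norm_mult mult_left_le simp del: of_nat_Suc)
qed

lemma norm_fact_Suc_le: "padic_norm (fact (Suc j) :: 'a) \<le> padic_norm (fact j :: 'a)"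
  using padic_norm_of_nat_le_1[of "Suc j", where 'a = 'a]
  by (simp add: padic_norm_mult mult_left_le_one_le del: of_nat_Suc)

text \<open>The shift to \<open>Suc i\<close> matches the exponent \<open>j - 1\<close> in
  \<open>norm_fact_ge\<close>. The split-off factor gives decay and the uniform bound by the norm of
  \<open>a\<close> at once.\<close>

lemma norm_exp_term_le:
  fixes a :: 'a
  shows "padic_norm (a ^ Suc i / fact (Suc i)) \<le> padic_norm a * (padic_norm a / radius) ^ i"
proof -
  have "padic_norm (a ^ Suc i / fact (Suc i)) \<le> padic_norm a ^ Suc i / radius ^ i"
    unfolding padic_norm_divide padic_norm_power
    using norm_fact_ge[of "Suc i"] radius_pos
    by (intro divide_left_mono mult_pos_pos) (auto simp del: fact_Suc)
  then show ?thesis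
    by (simp add: power_divide)
qed

lemma norm_div_radius_power_le_1:
  fixes a :: 'a
  assumes "padic_norm a < radius"
  shows "(padic_norm a / radius) ^ i \<le> 1"
  using assms radius_pos by (intro power_le_one) auto

lemma norm_exp_term_le':
  fixes a :: 'a
  assumes "padic_norm a < radius"
  shows "padic_norm (a ^ Suc i / fact (Suc i)) \<le> padic_norm a"
  using norm_exp_term_le norm_div_radius_power_le_1[OF assms]
  by (meson mult_left_le order_trans padic_norm_nonneg)

lemma tendsto_exp_bound:
  fixes a :: 'a
  assumes "padic_norm a < radius"
  shows "(\<lambda>i. padic_norm a * (padic_norm a / radius) ^ i) \<longlonglongrightarrow> 0"
proof -
  have "(\<lambda>i. (padic_norm a / radius) ^ i) \<longlonglongrightarrow> 0"
    using assms radius_pos by (intro LIMSEQ_realpow_zero) auto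
  then show ?thesis
    using tendsto_mult_right_zero by blast
qed

lemma exp_sums:
  fixes a :: 'a
  assumes "padic_norm a < radius"
  shows "(\<lambda>n. a ^ n / fact n) sums padic_exp a"
proof -
  have "(\<lambda>i. a ^ Suc i / fact (Suc i)) \<longlonglongrightarrow> 0"
    by (rule tendsto_0_padic_norm_le[OF tendsto_exp_bound[OF assms]])
      (use norm_exp_term_le[of a] in simp)
  then have "(\<lambda>n. a ^ n / fact n) \<longlonglongrightarrow> 0"
    by (rule LIMSEQ_imp_Suc)
  then show ?thesis
    unfolding padic_exp_def by (intro summable_sums nonarch_summable complete_UNIV)
qed

lemma exp_0: "padic_exp (0 :: 'a) = 1"
proof -
  have "(\<lambda>n. (0 :: 'a) ^ n / fact n) = (\<lambda>n. if n = 0 then 1 else 0)"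
    by auto
  then have "(\<lambda>n. (0 :: 'a) ^ n / fact n) sums 1"
    using sums_single[of 0 "\<lambda>_. 1 :: 'a"] by simp
  then show ?thesis
    unfolding padic_exp_def by (simp add: sums_iff)
qed

lemma norm_exp_minus_linear:
  fixes a :: 'a
  assumes "padic_norm a < radius"
  shows "padic_norm (padic_exp a - 1 - a) \<le> padic_norm a ^ 2 / radius"
proof (rule padic_norm_sums_le)
  show "(\<lambda>i. a ^ (i + 2) / fact (i + 2)) sums (padic_exp a - 1 - a)"
    using sums_tail[OF exp_sums[OF assms], of 2] by (simp add: numeral_2_eq_2 algebra_simps)
  show "padic_norm (a ^ (i + 2) / fact (i + 2)) \<le> padic_norm a ^ 2 / radius" for i
  proof -
    have "padic_norm (a ^ (i + 2) / fact (i + 2)) \<le> padic_norm a * (padic_norm a / radius) ^ Suc i"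
      using norm_exp_term_le[of a "Suc i"] by simp
    also have "\<dots> = padic_norm a ^ 2 / radius * (padic_norm a / radius) ^ i"
      by (simp add: power2_eq_square)
    also have "\<dots> \<le> padic_norm a ^ 2 / radius"
      using norm_div_radius_power_le_1[OF assms, of i] radius_pos by (intro mult_left_le) auto
    finally show ?thesis .
  qed
qed (use radius_pos in auto)


text \<open>The product is a binomial coefficient times \<open>a ^ i * b ^ j / fact (i + j)\<close>,
  so only one factorial has to be estimated. The last two assumptions exclude
  \<open>i + j = 0\<close>.\<close>

lemma norm_exp_product_term_le:
  fixes a b :: 'a
  assumes "padic_norm a \<le> s" "padic_norm b \<le> s" "s < radius" "n \<le> i + j" "i < n"
  shows "padic_norm (a ^ i / fact i * (b ^ j / fact j)) \<le> radius * (s / radius) ^ n"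
proof -
  have s: "0 \<le> s"
    using assms(1) padic_norm_nonneg order_trans by blast
  obtain k where k: "i + j = Suc k"
    using assms(4,5) by (cases "i + j") auto
  have "a ^ i / fact i * (b ^ j / fact j) = of_nat (i + j choose i) * (a ^ i * b ^ j) / fact (Suc k)"
    by (simp add: binomial_fact flip: k)
  also have "padic_norm \<dots> \<le> 1 * (s ^ i * s ^ j) / radius ^ k"
    unfolding padic_norm_divide padic_norm_mult padic_norm_power
    using s radius_pos assms(1,2) norm_fact_ge[of "Suc k"]
    by (intro frac_le mult_mono power_mono padic_norm_of_nat_le_1) (auto simp del: fact_Suc)
  also have "\<dots> = radius * (s / radius) ^ (i + j)"
    using radius_pos by (simp add: k power_divide flip: power_add)
  also have "\<dots> \<le> radius * (s / radius) ^ n"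
    using s radius_pos assms(3,4) by (intro mult_left_mono power_decreasing) auto
  finally show ?thesis .
qed

text \<open>The product of partial sums ranges over a square of index pairs, the partial sum for
  \<open>a + b\<close> over the triangle \<open>i + j < n\<close>. The terms in between are
  uniformly small.\<close>

lemma exp_add:
  fixes a b :: 'a
  assumes "padic_norm a < radius" "padic_norm b < radius"
  shows "padic_exp (a + b) = padic_exp a * padic_exp b"
proof -
  define s where "s = max (padic_norm a) (padic_norm b)"
  have s: "padic_norm a \<le> s" "padic_norm b \<le> s" "s < radius" "0 \<le> s"
    using assms by (auto simp: s_def le_max_iff_disj)
  let ?f = "\<lambda>i. a ^ i / fact i" and ?g = "\<lambda>i. b ^ i / fact i"
  let ?P = "\<lambda>n. (\<Sum>i<n. ?f i) * (\<Sum>j<n. ?g j)"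
  let ?S = "\<lambda>n. \<Sum>k<n. (a + b) ^ k / fact k"
  have "?P \<longlonglongrightarrow> padic_exp a * padic_exp b"
    using exp_sums[OF assms(1)] exp_sums[OF assms(2)] unfolding sums_def by (intro tendsto_mult)
  moreover have "padic_norm (a + b) < radius"
    using padic_norm_add[of a b] s(3) unfolding s_def by linarith
  then have "?S \<longlonglongrightarrow> padic_exp (a + b)"
    using exp_sums unfolding sums_def by blast
  moreover have "(\<lambda>n. ?P n - ?S n) \<longlonglongrightarrow> 0"
  proof (rule tendsto_0_padic_norm_le)
    have "(\<lambda>n. (s / radius) ^ n) \<longlonglongrightarrow> 0"
      using s radius_pos by (intro LIMSEQ_realpow_zero) auto
    then show "(\<lambda>n. radius * (s / radius) ^ n) \<longlonglongrightarrow> 0"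
      using tendsto_mult_right_zero by blast
    show "padic_norm (?P n - ?S n - 0) \<le> radius * (s / radius) ^ n" for n
    proof -
      have "?S n = (\<Sum>k<n. \<Sum>i\<le>k. ?f i * ?g (k - i))"
      proof (rule sum.cong[OF refl])
        fix k
        have "(a + b) ^ k / fact k = (\<Sum>i\<le>k. of_nat (k choose i) * a ^ i * b ^ (k - i) / fact k)"
          by (simp add: binomial_ring sum_divide_distrib)
        also have "\<dots> = (\<Sum>i\<le>k. ?f i * ?g (k - i))"
          by (intro sum.cong refl) (simp add: binomial_fact)
        finally show "(a + b) ^ k / fact k = \<dots>" .
      qed
      then have S: "?S n = (\<Sum>(i, j)\<in>{(i, j). i + j < n}. ?f i * ?g j)"
        by (simp add: sum.triangle_reindex)
      have P: "?P n = (\<Sum>(i, j)\<in>{..<n} \<times> {..<n}. ?f i * ?g j)"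
        by (simp add: sum_product sum.cartesian_product)
      have "?P n - ?S n = (\<Sum>(i, j)\<in>{..<n} \<times> {..<n} - {(i, j). i + j < n}. ?f i * ?g j)"
        unfolding S P by (intro sum_diff[symmetric]) auto
      also have "padic_norm \<dots> \<le> radius * (s / radius) ^ n"
      proof (rule padic_norm_sum_le)
        fix z assume "z \<in> {..<n} \<times> {..<n} - {(i, j). i + j < n}"
        then obtain i j where z: "z = (i, j)" "n \<le> i + j" "i < n"
          by (cases z) auto
        then show "padic_norm (case z of (i, j) \<Rightarrow> ?f i * ?g j) \<le> radius * (s / radius) ^ n"
          using norm_exp_product_term_le[OF s(1-3) z(2,3)] by simp
      qed (use s radius_pos in auto)
      finally show ?thesis by simp
    qed
  qed
  ultimately have "(\<lambda>n. ?P n - (?P n - ?S n)) \<longlonglongrightarrow> padic_exp a * padic_exp b - 0"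
    by (intro tendsto_diff)
  then have "?S \<longlonglongrightarrow> padic_exp a * padic_exp b"
    by simp
  then show ?thesis
    using \<open>?S \<longlonglongrightarrow> padic_exp (a + b)\<close> LIMSEQ_unique by blast
qed

lemma exp_of_nat_mult:
  fixes a :: 'a
  assumes "padic_norm a < radius"
  shows "padic_exp (of_nat n * a) = padic_exp a ^ n"
proof (induction n)
  case (Suc n)
  have "padic_norm (of_nat n * a) < radius"
    using assms mult_left_le_one_le[OF _ _ padic_norm_of_nat_le_1[of n, where 'a = 'a], of "padic_norm a"]
    by (simp add: padic_norm_mult)
  then show ?case
    using assms Suc by (simp add: distrib_right exp_add)
qed (simp add: exp_0)

subsection \<open>The logarithm\<close>

text \<open>Comes from \<open>Suc i * (n choose Suc i) = n * (n - 1 choose i)\<close>. The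
  denominator is weakened to a factorial to match the exponential terms.\<close>

lemma norm_binomial_Suc_le:
  "padic_norm (of_nat (n choose Suc i) :: 'a) \<le> padic_norm (of_nat n :: 'a) / padic_norm (fact (Suc i) :: 'a)"
proof -
  have "Suc i * (n choose Suc i) = n * (n - 1 choose i)"
    using times_binomial_minus1_eq[of "Suc i" n] by simp
  then have "padic_norm (of_nat (Suc i) :: 'a) * padic_norm (of_nat (n choose Suc i) :: 'a)
      = padic_norm (of_nat n :: 'a) * padic_norm (of_nat (n - 1 choose i) :: 'a)"
    by (metis of_nat_mult padic_norm_mult)
  also have "\<dots> \<le> padic_norm (of_nat n :: 'a)"
    by (simp add: mult_left_le padic_norm_of_nat_le_1)
  finally have "padic_norm (fact (Suc i) :: 'a) * padic_norm (of_nat (n choose Suc i) :: 'a) \<le> padic_norm (of_nat n :: 'a)"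
    using mult_right_mono[OF norm_fact_le_of_nat[of "Suc i"], of "padic_norm (of_nat (n choose Suc i) :: 'a)"]
    by simp
  then show ?thesis
    by (simp add: pos_le_divide_eq mult.commute del: fact_Suc)
qed

text \<open>Modulo \<open>Suc m\<close> the number \<open>m\<close> is -1, and the generalized
  binomial coefficient of -1 over \<open>i\<close> is \<open>(- 1) ^ i\<close>. Pascal's rule
  carries the error from \<open>i\<close> to \<open>Suc i\<close>.\<close>

lemma norm_binomial_minus_sign_le:
  "padic_norm (of_nat (m choose i) - (- 1) ^ i :: 'a)
     \<le> padic_norm (of_nat (Suc m) :: 'a) / padic_norm (fact i :: 'a)"
proof (induction i)
  case (Suc i)
  have "of_nat (m choose Suc i) - (- 1) ^ Suc i
      = of_nat (Suc m choose Suc i) - (of_nat (m choose i) - (- 1) ^ i :: 'a)"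
    by simp
  also have "padic_norm \<dots> \<le> padic_norm (of_nat (Suc m) :: 'a) / padic_norm (fact (Suc i) :: 'a)"
  proof (rule padic_norm_diff_le[OF norm_binomial_Suc_le order_trans[OF Suc.IH]])
    show "padic_norm (of_nat (Suc m) :: 'a) / padic_norm (fact i :: 'a)
        \<le> padic_norm (of_nat (Suc m) :: 'a) / padic_norm (fact (Suc i) :: 'a)"
      by (intro divide_left_mono norm_fact_Suc_le mult_pos_pos) (auto simp del: fact_Suc)
  qed
  finally show ?case .
qed simp

lemma binomial_sums: "(\<lambda>i. of_nat (n choose i) * x ^ i) sums ((1 + x :: 'a) ^ n)"
proof -
  have "(\<lambda>i. of_nat (n choose i) * x ^ i) sums (\<Sum>i\<le>n. of_nat (n choose i) * x ^ i)"
    by (intro sums_finite) auto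
  also have "(\<Sum>i\<le>n. of_nat (n choose i) * x ^ i) = (1 + x) ^ n"
    by (simp add: binomial_ring add.commute[of 1])
  finally show ?thesis .
qed

text \<open>In the binomial expansion the linear term \<open>of_nat n * x\<close> dominates: all
  later terms are smaller by at least the factor \<open>padic_norm x / radius\<close>.\<close>

lemma norm_power_minus_1:
  fixes x :: 'a
  assumes "padic_norm x < radius"
  shows "padic_norm ((1 + x) ^ n - 1) = padic_norm (of_nat n :: 'a) * padic_norm x"
proof (cases "n = 0 \<or> x = 0")
  case False
  let ?B = "padic_norm (of_nat n :: 'a) * padic_norm x"
  have "padic_norm ((1 + x) ^ n - 1 - of_nat n * x) \<le> ?B * (padic_norm x / radius)"
  proof (rule padic_norm_sums_le)
    show "(\<lambda>i. of_nat (n choose (i + 2)) * x ^ (i + 2)) sums ((1 + x) ^ n - 1 - of_nat n * x)"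
      using sums_tail[OF binomial_sums[of n x], of 2] by (simp add: numeral_2_eq_2 algebra_simps)
    show "padic_norm (of_nat (n choose (i + 2)) * x ^ (i + 2)) \<le> ?B * (padic_norm x / radius)" for i
    proof -
      have "padic_norm (of_nat (n choose (i + 2)) * x ^ (i + 2))
          \<le> padic_norm (of_nat n :: 'a) / padic_norm (fact (i + 2) :: 'a) * padic_norm x ^ (i + 2)"
        unfolding padic_norm_mult padic_norm_power
        using norm_binomial_Suc_le[of n "Suc i"] by (intro mult_right_mono) auto
      also have "\<dots> = padic_norm (of_nat n :: 'a) * padic_norm (x ^ Suc (Suc i) / fact (Suc (Suc i)))"
        by (simp add: padic_norm_divide padic_norm_mult padic_norm_power del: fact_Suc)
      also have "\<dots> \<le> padic_norm (of_nat n :: 'a) * (padic_norm x * (padic_norm x / radius) ^ Suc i)"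
        by (intro mult_left_mono norm_exp_term_le) simp
      also have "\<dots> = ?B * (padic_norm x / radius) * (padic_norm x / radius) ^ i"
        by simp
      also have "\<dots> \<le> ?B * (padic_norm x / radius)"
        using norm_div_radius_power_le_1[OF assms, of i] radius_pos
        by (intro mult_left_le) auto
      finally show ?thesis .
    qed
  qed (use radius_pos in auto)
  also have "\<dots> < ?B"
    using False assms radius_pos mult_strict_left_mono[of "padic_norm x / radius" 1 ?B] by simp
  finally have "padic_norm ((1 + x) ^ n - 1 - of_nat n * x) < padic_norm (of_nat n * x)"
    by (simp add: padic_norm_mult)
  then show ?thesis
    using padic_norm_add_eq_right by (fastforce simp: padic_norm_mult)
qed auto

text \<open>The terms are dominated by those of the exponential series, which yields both
  convergence and the bound.\<close>

lemma log_sums: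
  fixes x :: 'a
  assumes "padic_norm x < radius"
  shows "(\<lambda>i. (- 1) ^ i * x ^ Suc i / of_nat (Suc i)) sums padic_log (1 + x)"
    and "padic_norm (padic_log (1 + x)) \<le> padic_norm x"
proof -
  have term_le: "padic_norm ((- 1) ^ i * x ^ Suc i / of_nat (Suc i)) \<le> padic_norm (x ^ Suc i / fact (Suc i))" for i
  proof -
    have "padic_norm ((- 1) ^ i * x ^ Suc i / of_nat (Suc i)) = padic_norm (x ^ Suc i) / padic_norm (of_nat (Suc i) :: 'a)"
      by (simp add: padic_norm_divide padic_norm_mult padic_norm_power del: of_nat_Suc)
    also have "\<dots> \<le> padic_norm (x ^ Suc i) / padic_norm (fact (Suc i) :: 'a)"
      by (intro divide_left_mono norm_fact_le_of_nat mult_pos_pos)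
        (auto simp del: fact_Suc of_nat_Suc)
    finally show ?thesis
      by (simp add: padic_norm_divide)
  qed
  have "(\<lambda>i. (- 1) ^ i * x ^ Suc i / of_nat (Suc i)) \<longlonglongrightarrow> 0"
    by (rule tendsto_0_padic_norm_le[OF tendsto_exp_bound[OF assms]])
      (metis diff_zero norm_exp_term_le order_trans term_le)
  then show sums: "(\<lambda>i. (- 1) ^ i * x ^ Suc i / of_nat (Suc i)) sums padic_log (1 + x)"
    using summable_sums[OF nonarch_summable[OF complete_UNIV]] unfolding padic_log_def by simp
  show "padic_norm (padic_log (1 + x)) \<le> padic_norm x"
    using order_trans[OF term_le norm_exp_term_le'[OF assms]]
    by (rule padic_norm_sums_le[OF sums]) simp
qed

text \<open>With \<open>n = Suc m\<close>, the coefficients of \<open>x ^ Suc i\<close> are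
  \<open>n / Suc i\<close> times \<open>m choose i\<close> and \<open>(- 1) ^ i\<close>
  respectively. These two differ by a quantity carrying a second factor \<open>n\<close>.\<close>

lemma norm_power_minus_log_le:
  fixes x :: 'a
  assumes "padic_norm x < radius"
  shows "padic_norm ((1 + x) ^ n - 1 - of_nat n * padic_log (1 + x)) \<le> padic_norm (of_nat n :: 'a) ^ 2 * padic_norm x"
proof (cases n)
  case (Suc m)
  let ?c = "\<lambda>i. of_nat (m choose i) - (- 1) ^ i :: 'a"
  let ?t = "\<lambda>i. of_nat n * ?c i * x ^ Suc i / of_nat (Suc i)"
  show ?thesis
  proof (rule padic_norm_sums_le)
    have 1: "(\<lambda>i. of_nat (n choose Suc i) * x ^ Suc i) sums ((1 + x) ^ n - 1)"
      using sums_tail[OF binomial_sums[of n x], of 1] by simp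
    have "(\<lambda>k. (\<Sum>i<k. of_nat (n choose Suc i) * x ^ Suc i)
          - of_nat n * (\<Sum>i<k. (- 1) ^ i * x ^ Suc i / of_nat (Suc i)))
        \<longlonglongrightarrow> (1 + x) ^ n - 1 - of_nat n * padic_log (1 + x)"
      using 1 log_sums(1)[OF assms] unfolding sums_def
      by (intro tendsto_diff tendsto_mult tendsto_const)
    moreover have "of_nat (n choose Suc i) * x ^ Suc i - of_nat n * ((- 1) ^ i * x ^ Suc i / of_nat (Suc i)) = ?t i" for i
    proof -
      have "of_nat (Suc i) * of_nat (n choose Suc i) = of_nat n * (of_nat (m choose i) :: 'a)"
        unfolding Suc of_nat_mult[symmetric] Suc_times_binomial by (rule refl)
      then have "of_nat (n choose Suc i) = of_nat n * of_nat (m choose i) / (of_nat (Suc i) :: 'a)"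
        by (simp add: field_simps del: of_nat_Suc)
      then show ?thesis
        by (simp add: algebra_simps diff_divide_distrib del: of_nat_Suc)
    qed
    then have "(\<Sum>i<k. of_nat (n choose Suc i) * x ^ Suc i)
          - of_nat n * (\<Sum>i<k. (- 1) ^ i * x ^ Suc i / of_nat (Suc i)) = (\<Sum>i<k. ?t i)" for k
      by (simp only: sum_distrib_left flip: sum_subtractf)
    ultimately show "?t sums ((1 + x) ^ n - 1 - of_nat n * padic_log (1 + x))"
      unfolding sums_def by simp
    show "padic_norm (?t i) \<le> padic_norm (of_nat n :: 'a) ^ 2 * padic_norm x" for i
    proof -
      have "padic_norm (?t i) = padic_norm (of_nat n :: 'a) * padic_norm (?c i)
          * (padic_norm (x ^ Suc i) / padic_norm (of_nat (Suc i) :: 'a))"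
        by (simp add: padic_norm_divide padic_norm_mult del: of_nat_Suc)
      also have "\<dots> \<le> padic_norm (of_nat n :: 'a) * (padic_norm (of_nat n :: 'a) / padic_norm (fact i :: 'a))
          * (padic_norm (x ^ Suc i) / padic_norm (of_nat (Suc i) :: 'a))"
        unfolding Suc by (intro mult_right_mono mult_left_mono norm_binomial_minus_sign_le) auto
      also have "\<dots> = padic_norm (of_nat n :: 'a) ^ 2 * padic_norm (x ^ Suc i / fact (Suc i))"
        by (simp add: padic_norm_divide padic_norm_mult power2_eq_square field_simps del: of_nat_Suc)
      also have "\<dots> \<le> padic_norm (of_nat n :: 'a) ^ 2 * padic_norm x"
        using norm_exp_term_le'[OF assms] by (intro mult_left_mono) auto
      finally show ?thesis .
    qed
  qed auto
qed simp

lemma tendsto_p_power_0: "(\<lambda>k. of_nat (p ^ k) :: 'a) \<longlonglongrightarrow> 0"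
proof (rule tendsto_0_padic_norm_le)
  show "(\<lambda>k. (1 / real p) ^ k) \<longlonglongrightarrow> 0"
    using p_gt_1 by (intro LIMSEQ_realpow_zero) auto
qed (simp add: padic_norm_power norm_p)

text \<open>
  Both \<open>(1 + x) ^ n\<close> and \<open>exp (log (1 + x)) ^ n\<close> agree with \<open>1 + n * log (1 + x)\<close>
  up to order \<open>n ^ 2\<close>, while taking \<open>n\<close>-th powers scales distances only by \<open>n\<close>. Now let \<open>n\<close> run
  through the powers of \<open>p\<close>.
\<close>

lemma exp_log:
  fixes x :: 'a
  assumes "padic_norm x < radius"
  shows "padic_exp (padic_log (1 + x)) = 1 + x"
proof -
  define L u v where "L = padic_log (1 + x)" and "u = padic_exp L" and "v = u / (1 + x)"
  have L: "padic_norm L \<le> padic_norm x" "padic_norm L < radius"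
    using log_sums(2)[OF assms] assms by (auto simp: L_def)
  have quad: "padic_norm L ^ 2 / radius \<le> padic_norm x"
    using L assms radius_pos mult_mono[of "padic_norm L" "padic_norm x" "padic_norm L" radius]
    by (simp add: power2_eq_square field_simps)
  have norm_1x: "padic_norm (1 + x) = 1"
    using padic_norm_add_eq_right[of x 1] assms radius_less_1 by (simp add: add.commute)
  then have nz: "1 + x \<noteq> 0"
    by auto
  \<comment> \<open>Passing through \<open>L\<close> bounds \<open>u - 1 - x\<close>. This puts
    \<open>v\<close> within \<open>radius\<close> of 1, so \<open>norm_power_minus_1\<close> applies
    to its powers.\<close>
  have "padic_norm (u - 1 - L) \<le> padic_norm x"
    using norm_exp_minus_linear[OF L(2)] quad unfolding u_def by linarith
  then have "padic_norm ((u - 1 - L) + (L - x)) \<le> padic_norm x"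
    using padic_norm_diff_le[of L "padic_norm x" x] L by (intro padic_norm_add_le) auto
  moreover have "v - 1 = ((u - 1 - L) + (L - x)) / (1 + x)"
    using nz by (simp add: v_def field_simps)
  ultimately have "padic_norm (v - 1) < radius"
    using assms norm_1x by (simp add: padic_norm_divide)
  then have vpow: "padic_norm (v ^ n - 1) = padic_norm (of_nat n :: 'a) * padic_norm (v - 1)" for n
    using norm_power_minus_1[of "v - 1"] by simp
  have le: "padic_norm (v - 1) \<le> padic_norm (of_nat n :: 'a) * padic_norm x" if "n > 0" for n
  proof -
    have "padic_norm (of_nat n * L) \<le> padic_norm L"
      by (simp add: padic_norm_mult mult_left_le_one_le padic_norm_of_nat_le_1)
    then have "padic_norm (u ^ n - 1 - of_nat n * L) \<le> padic_norm (of_nat n * L) ^ 2 / radius"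
      unfolding u_def using norm_exp_minus_linear[of "of_nat n * L"] L
      by (simp add: exp_of_nat_mult)
    also have "\<dots> = padic_norm (of_nat n :: 'a) ^ 2 * (padic_norm L ^ 2 / radius)"
      by (simp add: padic_norm_mult power_mult_distrib)
    also have "\<dots> \<le> padic_norm (of_nat n :: 'a) ^ 2 * padic_norm x"
      using quad by (intro mult_left_mono) auto
    finally have "padic_norm ((u ^ n - 1 - of_nat n * L) - ((1 + x) ^ n - 1 - of_nat n * L))
        \<le> padic_norm (of_nat n :: 'a) ^ 2 * padic_norm x"
      using norm_power_minus_log_le[OF assms, of n] unfolding L_def by (rule padic_norm_diff_le)
    \<comment> \<open>As \<open>1 + x\<close> has norm 1, the left side has norm
      \<open>padic_norm (of_nat n) * padic_norm (v - 1)\<close>; one factor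
      \<open>padic_norm (of_nat n)\<close> then cancels.\<close>
    moreover have "u ^ n - (1 + x) ^ n = (1 + x) ^ n * (v ^ n - 1)"
      using nz by (simp add: v_def power_divide field_simps)
    ultimately have "padic_norm (of_nat n :: 'a) * padic_norm (v - 1) \<le> padic_norm (of_nat n :: 'a) ^ 2 * padic_norm x"
      by (simp add: padic_norm_mult padic_norm_power norm_1x vpow)
    then show ?thesis
      using that mult_le_cancel_left_pos[of "padic_norm (of_nat n :: 'a)"]
      by (simp add: power2_eq_square mult.assoc)
  qed
  have "(\<lambda>k. padic_norm (of_nat (p ^ k) :: 'a) * padic_norm x) \<longlonglongrightarrow> 0"
    using tendsto_p_power_0 by (intro tendsto_mult_left_zero) (simp add: tendsto_padic_norm_iff)
  moreover have "padic_norm (v - 1) \<le> padic_norm (of_nat (p ^ k) :: 'a) * padic_norm x" for k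
    using p_gt_1 by (intro le) simp
  ultimately have "padic_norm (v - 1) \<le> 0"
    by (intro tendsto_lowerbound) auto
  then have "v = 1"
    by (metis eq_iff_diff_eq_0 order_antisym padic_norm_eq_0_iff padic_norm_nonneg)
  then show ?thesis
    using nz by (simp add: v_def u_def L_def)
qed

end

subsection \<open>Geometric sums and the \<open>q\<close>-integral\<close>

definition geometric :: "'a::comm_ring_1 \<Rightarrow> nat \<Rightarrow> 'a" where
  "geometric r m = (\<Sum>i<m. r ^ i)"

lemma geometric_eq: "(1 - r) * geometric r m = 1 - r ^ m"
  by (simp add: geometric_def one_diff_power_eq)

lemma geometric_1 [simp]: "geometric 1 m = of_nat m"
  by (simp add: geometric_def)

lemma geometric_0_right [simp]: "geometric r 0 = 0"
  by (simp add: geometric_def)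

lemma geometric_Suc: "geometric r (Suc m) = 1 + r * geometric r m"
  by (simp add: geometric_def sum.lessThan_Suc_shift sum_distrib_left del: sum.lessThan_Suc)

text \<open>The \<open>m * k\<close> exponents fall into \<open>k\<close> consecutive blocks of
  length \<open>m\<close>.\<close>

lemma geometric_mult: "geometric r (m * k) = geometric r m * geometric (r ^ m) k"
proof -
  have "geometric r (a + b) = geometric r a + r ^ a * geometric r b" for a b
    by (induction b) (simp_all add: geometric_def algebra_simps power_add)
  then show ?thesis
    by (induction k) (simp_all add: geometric_Suc algebra_simps)
qed

context padic_field begin

lemma padic_pow_of_nat:
  fixes q :: 'a
  assumes "padic_norm (q - 1) < radius"
  shows "padic_pow q (of_nat n) = q ^ n"
proof -
  have "padic_norm (padic_log q) < radius"
    using log_sums(2)[OF assms] assms by simp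
  then show ?thesis
    using exp_log[OF assms] by (simp add: padic_pow_def exp_of_nat_mult)
qed

text \<open>For \<open>r\<close> different from 1, multiply by \<open>1 - r\<close>, apply
  \<open>norm_power_minus_1\<close> and cancel.\<close>

lemma norm_geometric:
  fixes r :: 'a
  assumes "padic_norm (r - 1) < radius"
  shows "padic_norm (geometric r m) = padic_norm (of_nat m :: 'a)"
proof (cases "r = 1")
  case False
  have "padic_norm (r - 1) * padic_norm (geometric r m) = padic_norm (r ^ m - 1)"
    using geometric_eq[of r m] padic_norm_minus_commute by (metis padic_norm_mult)
  also have "\<dots> = padic_norm (of_nat m :: 'a) * padic_norm (r - 1)"
    using norm_power_minus_1[OF assms, of m] by simp
  finally show ?thesis
    using False by simp
qed simp

lemma geometric_neq_0:
  fixes r :: 'a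
  assumes "padic_norm (r - 1) < radius" "m > 0"
  shows "geometric r m \<noteq> 0"
  using norm_geometric[OF assms(1), of m] assms(2) by (metis neq0_conv of_nat_eq_0_iff padic_norm_eq_0_iff)

lemma tendsto_geometric_0:
  fixes r :: 'a
  assumes "padic_norm (r - 1) < radius"
  shows "(\<lambda>N. geometric r (p ^ N)) \<longlonglongrightarrow> 0"
  using tendsto_p_power_0 by (simp add: tendsto_padic_norm_iff norm_geometric[OF assms])

lemma tendsto_power_p_power_1:
  fixes r :: 'a
  assumes "padic_norm (r - 1) < radius"
  shows "(\<lambda>N. r ^ (p ^ N)) \<longlonglongrightarrow> 1"
proof -
  have "(\<lambda>N. 1 - (1 - r) * geometric r (p ^ N)) \<longlonglongrightarrow> 1 - (1 - r) * 0"
    by (intro tendsto_diff tendsto_mult tendsto_const tendsto_geometric_0 assms)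
  then show ?thesis
    by (simp add: geometric_eq)
qed

section \<open>Approximating sums of the \<open>q\<close>-integral\<close>

context
  fixes q :: 'a and \<alpha> :: nat
  assumes q_near_1: "padic_norm (q - 1) < radius" and \<alpha>_pos: "\<alpha> > 0"
begin

lemma q_power_near_1: "padic_norm (q ^ n - 1) < radius"
proof -
  have "padic_norm (q ^ n - 1) = padic_norm (of_nat n :: 'a) * padic_norm (q - 1)"
    using norm_power_minus_1[OF q_near_1, of n] by simp
  also have "\<dots> \<le> padic_norm (q - 1)"
    by (simp add: mult_left_le_one_le padic_norm_of_nat_le_1)
  finally show ?thesis
    using q_near_1 by simp
qed

text \<open>The norm of \<open>q ^ n - 1\<close> is that of \<open>of_nat n * (q - 1)\<close>, so
  the disc contains no nontrivial roots of unity.\<close>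

lemma q_power_eq_1_iff: "n > 0 \<Longrightarrow> q ^ n = 1 \<longleftrightarrow> q = 1"
  using norm_power_minus_1[OF q_near_1, of n]
  by (metis add_diff_cancel_left' diff_add_cancel mult_eq_0_iff of_nat_eq_0_iff order_less_irrefl
      padic_norm_eq_0_iff power_one right_minus_eq)

lemma q_number_base_of_nat:
  assumes "a > 0"
  shows "q_number_base a q (of_nat m) = geometric (q ^ a) m"
proof (cases "q ^ a = 1")
  case False
  have "padic_pow q (of_nat a * of_nat m) = (q ^ a) ^ m"
    using padic_pow_of_nat[OF q_near_1, of "a * m"] by (simp add: power_mult)
  then show ?thesis
    using False geometric_eq[of "q ^ a" m] by (simp add: q_number_base_def field_simps)
qed (simp add: q_number_base_def)

definition integral_approx :: "nat \<Rightarrow> nat \<Rightarrow> nat \<Rightarrow> 'a" where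
  "integral_approx x n N =
     1 / geometric q (p ^ N) * (\<Sum>y<p ^ N. geometric (q ^ \<alpha>) (x + y) ^ n * q ^ y)"

text \<open>The two sequences agree term by term, so their \<open>lim\<close> agree before any
  convergence is known.\<close>

lemma q_bernoulli_poly_eq_lim: "q_bernoulli_poly p \<alpha> n q (of_nat x) = lim (integral_approx x n)"
proof -
  have "q_number_base \<alpha> q (of_nat x + of_nat y) = geometric (q ^ \<alpha>) (x + y)" for y
    using q_number_base_of_nat[OF \<alpha>_pos, of "x + y"] by simp
  moreover have "q_number q (of_nat (p ^ N)) = geometric q (p ^ N)" for N
    using q_number_base_of_nat[of 1 "p ^ N"] by simp
  ultimately show ?thesis
    unfolding q_bernoulli_poly_def q_integral_def integral_approx_def by presburger
qed

lemma geometric_q_neq_0: "geometric q (p ^ N) \<noteq> 0"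
  using p_gt_1 by (intro geometric_neq_0 q_near_1) simp

lemma integral_approx_0: "integral_approx x 0 N = 1"
  using geometric_q_neq_0 by (simp add: integral_approx_def flip: geometric_def)

text \<open>Besides giving the recurrence, this transfers convergence from \<open>x = 0\<close> to
  \<open>x = 1\<close>.\<close>

lemma integral_approx_1_binomial:
  "integral_approx 1 n N = (\<Sum>k\<le>n. of_nat (n choose k) * (q ^ \<alpha>) ^ k * integral_approx 0 k N)"
proof -
  have "geometric (q ^ \<alpha>) (1 + y) ^ n * q ^ y
      = (\<Sum>k\<le>n. of_nat (n choose k) * (q ^ \<alpha>) ^ k * (geometric (q ^ \<alpha>) y ^ k * q ^ y))" for y
  proof -
    have "geometric (q ^ \<alpha>) (1 + y) ^ n = (q ^ \<alpha> * geometric (q ^ \<alpha>) y + 1) ^ n"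
      by (simp add: geometric_Suc add.commute)
    also have "\<dots> = (\<Sum>k\<le>n. of_nat (n choose k) * (q ^ \<alpha>) ^ k * geometric (q ^ \<alpha>) y ^ k)"
      by (subst binomial_ring) (simp add: power_mult_distrib mult.assoc)
    finally show ?thesis
      by (simp add: sum_distrib_right mult.assoc)
  qed
  then have "(\<Sum>y<p ^ N. geometric (q ^ \<alpha>) (1 + y) ^ n * q ^ y)
      = (\<Sum>y<p ^ N. \<Sum>k\<le>n. of_nat (n choose k) * (q ^ \<alpha>) ^ k * (geometric (q ^ \<alpha>) y ^ k * q ^ y))"
    by (intro sum.cong refl)
  also have "\<dots> = (\<Sum>k\<le>n. of_nat (n choose k) * (q ^ \<alpha>) ^ k * (\<Sum>y<p ^ N. geometric (q ^ \<alpha>) y ^ k * q ^ y))"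
    by (subst sum.swap) (simp add: sum_distrib_left)
  finally show ?thesis
    by (simp add: integral_approx_def sum_distrib_left mult_ac)
qed

definition boundary_term :: "nat \<Rightarrow> nat \<Rightarrow> 'a" where
  "boundary_term n N = 1 / geometric q (p ^ N) * (geometric (q ^ \<alpha>) (p ^ N) ^ n * q ^ (p ^ N))"

text \<open>The factor \<open>q\<close> turns \<open>q ^ y\<close> into \<open>q ^ Suc y\<close>,
  matching the shifted argument. For positive \<open>n\<close> the lower end contributes 0 since
  \<open>geometric\<close> vanishes at 0.\<close>

lemma integral_approx_telescope:
  assumes "n > 0"
  shows "q * integral_approx 1 n N - integral_approx 0 n N = boundary_term n N"
proof -
  let ?h = "\<lambda>y. geometric (q ^ \<alpha>) y ^ n * q ^ y"
  have "q * integral_approx 1 n N - integral_approx 0 n N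
      = 1 / geometric q (p ^ N) * (\<Sum>y<p ^ N. ?h (Suc y) - ?h y)"
    by (simp add: integral_approx_def sum_subtractf sum_distrib_left algebra_simps)
  also have "(\<Sum>y<p ^ N. ?h (Suc y) - ?h y) = ?h (p ^ N) - ?h 0"
    by (rule sum_lessThan_telescope)
  finally show ?thesis
    using assms by (simp add: boundary_term_def)
qed

lemma tendsto_boundary_term:
  assumes "n > 0"
  shows "boundary_term n \<longlonglongrightarrow> (if n = 1 then of_nat \<alpha> / geometric q \<alpha> else 0)"
proof -
  have \<alpha>: "geometric q \<alpha> \<noteq> 0"
    by (intro geometric_neq_0 q_near_1 \<alpha>_pos)
  \<comment> \<open>Both sides come from factoring \<open>geometric q (\<alpha> * p ^ N)\<close> in
    the two possible orders.\<close>
  have ratio: "1 / geometric q (p ^ N) * geometric (q ^ \<alpha>) (p ^ N)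
      = 1 / geometric q \<alpha> * geometric (q ^ (p ^ N)) \<alpha>" for N
    using geometric_mult[of q \<alpha> "p ^ N"] geometric_mult[of q "p ^ N" \<alpha>] \<alpha> geometric_q_neq_0[of N]
    by (simp add: field_simps)
  have "boundary_term n N = 1 / geometric q \<alpha> * geometric (q ^ (p ^ N)) \<alpha>
      * geometric (q ^ \<alpha>) (p ^ N) ^ (n - 1) * q ^ (p ^ N)" for N
    unfolding ratio[symmetric] boundary_term_def using assms
    by (cases n) (simp_all add: mult_ac)
  \<comment> \<open>One power is absorbed into the ratio. The limit \<open>0 ^ (n - 1)\<close> of
    the remaining ones encodes the case distinction, being 1 exactly for
    \<open>n = 1\<close>.\<close>
  moreover have "(\<lambda>N. 1 / geometric q \<alpha> * geometric (q ^ (p ^ N)) \<alpha>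
      * geometric (q ^ \<alpha>) (p ^ N) ^ (n - 1) * q ^ (p ^ N))
    \<longlonglongrightarrow> 1 / geometric q \<alpha> * geometric 1 \<alpha> * 0 ^ (n - 1) * 1"
    unfolding geometric_def[of "q ^ _" \<alpha>] geometric_def[of 1 \<alpha>]
    by (intro tendsto_mult tendsto_const tendsto_sum tendsto_power_strong tendsto_power_p_power_1
        tendsto_geometric_0 q_near_1 q_power_near_1)
  ultimately have "boundary_term n \<longlonglongrightarrow> 1 / geometric q \<alpha> * geometric 1 \<alpha> * 0 ^ (n - 1) * 1"
    by presburger
  then show ?thesis
    using assms by (cases "n = 1") (auto simp: power_0_left)
qed

section \<open>Convergence of the approximating sums\<close>

lemma convergent_boundary_term: "n > 0 \<Longrightarrow> convergent (boundary_term n)"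
  using tendsto_boundary_term convergentI by blast

lemma convergent_linear_combination:
  fixes h :: "nat \<Rightarrow> 'a"
  assumes "\<And>k. k < (n::nat) \<Longrightarrow> convergent (f k)" "convergent g"
    and "\<And>N. h N = b * (g N - (\<Sum>k<n. c k * f k N))"
  shows "convergent h"
proof -
  obtain l where "\<And>k. k < n \<Longrightarrow> f k \<longlonglongrightarrow> l k"
    using assms(1) unfolding convergent_def by metis
  moreover obtain m where "g \<longlonglongrightarrow> m"
    using assms(2) unfolding convergent_def by metis
  ultimately have "h \<longlonglongrightarrow> b * (m - (\<Sum>k<n. c k * l k))"
    unfolding assms(3) by (intro tendsto_mult tendsto_diff tendsto_sum tendsto_const) auto
  then show ?thesis
    by (rule convergentI)
qed

text \<open>Telescoping and binomial expansion express a multiple of the \<open>n\<close>-th sum by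
  a boundary term and lower sums. The multiplier at level \<open>n\<close> is
  \<open>q ^ Suc (\<alpha> * n) - 1\<close>, which is invertible only for
  \<open>q \<noteq> 1\<close>; for \<open>q = 1\<close> the identity at level \<open>Suc n\<close>
  is used.\<close>

lemma convergent_integral_approx: "convergent (integral_approx 0 n)"
proof (induction n rule: less_induct)
  case (less n)
  show ?case
  proof (cases "q = 1")
    case True
    have "integral_approx 0 n N = 1 / of_nat (Suc n)
        * (boundary_term (Suc n) N - (\<Sum>k<n. of_nat (Suc n choose k) * integral_approx 0 k N))" for N
    proof -
      have "boundary_term (Suc n) N = integral_approx 1 (Suc n) N - integral_approx 0 (Suc n) N"
        using integral_approx_telescope[of "Suc n" N] True by simp
      \<comment> \<open>For \<open>q = 1\<close> the top term \<open>k = Suc n\<close> cancels,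
        leaving \<open>Suc n\<close> as the coefficient of the \<open>n\<close>-th sum.\<close>
      also have "\<dots> = (\<Sum>k\<le>n. of_nat (Suc n choose k) * integral_approx 0 k N)"
        unfolding integral_approx_1_binomial using True by simp
      also have "\<dots> = (\<Sum>k<n. of_nat (Suc n choose k) * integral_approx 0 k N)
          + of_nat (Suc n) * integral_approx 0 n N"
        by (simp del: binomial_Suc_Suc of_nat_Suc flip: lessThan_Suc_atMost)
      finally show ?thesis
        by (simp del: binomial_Suc_Suc of_nat_Suc)
    qed
    then show ?thesis
      using less.IH convergent_boundary_term[OF zero_less_Suc]
      by (rule convergent_linear_combination[where f = "integral_approx 0", rotated 2])
  next
    case False
    show ?thesis
    \<comment> \<open>The telescoping identity requires \<open>n > 0\<close>; at
      \<open>n = 0\<close> the sums are constantly 1.\<close>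
    proof (cases "n = 0")
      case True
      then show ?thesis
        using convergent_const[of "1 :: 'a"] by (simp add: integral_approx_0[abs_def])
    next
      case False
      then have n: "n > 0"
        by simp
      have q: "q * (q ^ \<alpha>) ^ n - 1 \<noteq> 0"
        using q_power_eq_1_iff[of "Suc (\<alpha> * n)"] \<open>q \<noteq> 1\<close> by (simp add: power_mult)
      have "integral_approx 0 n N = 1 / (q * (q ^ \<alpha>) ^ n - 1)
        * (boundary_term n N - (\<Sum>k<n. q * of_nat (n choose k) * (q ^ \<alpha>) ^ k * integral_approx 0 k N))" for N
      proof -
        have "integral_approx 1 n N = (\<Sum>k<n. of_nat (n choose k) * (q ^ \<alpha>) ^ k * integral_approx 0 k N)
            + (q ^ \<alpha>) ^ n * integral_approx 0 n N"
          unfolding integral_approx_1_binomial by (simp flip: lessThan_Suc_atMost)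
        then have "boundary_term n N - (\<Sum>k<n. q * of_nat (n choose k) * (q ^ \<alpha>) ^ k * integral_approx 0 k N)
            = (q * (q ^ \<alpha>) ^ n - 1) * integral_approx 0 n N"
          using integral_approx_telescope[OF n, of N] by (simp add: sum_distrib_left algebra_simps)
        then show ?thesis
          using q by simp
      qed
      then show ?thesis
        using less.IH convergent_boundary_term[OF n]
        by (rule convergent_linear_combination[where f = "integral_approx 0", rotated 2])
    qed
  qed
qed

section \<open>Passage to the limit\<close>

lemma q_bernoulli_0: "q_bernoulli_number p \<alpha> 0 q = 1"
  using q_bernoulli_poly_eq_lim[of 0 0]
  by (simp add: q_bernoulli_number_def integral_approx_0[abs_def])

lemma q_bernoulli_difference:
  assumes "n > 0"
  shows "q * q_bernoulli_poly p \<alpha> n q 1 - q_bernoulli_number p \<alpha> n q =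
    (if n = 1 then of_nat \<alpha> / q_number q (of_nat \<alpha>) else 0)"
proof -
  have "(\<lambda>N. \<Sum>k\<le>n. of_nat (n choose k) * (q ^ \<alpha>) ^ k * integral_approx 0 k N)
      \<longlonglongrightarrow> (\<Sum>k\<le>n. of_nat (n choose k) * (q ^ \<alpha>) ^ k * lim (integral_approx 0 k))"
    using convergent_integral_approx
    by (intro tendsto_sum tendsto_mult tendsto_const) (simp flip: convergent_LIMSEQ_iff)
  \<comment> \<open>Convergence must be established here, since \<open>lim\<close> says nothing
    about a divergent sequence.\<close>
  then have 1: "integral_approx 1 n \<longlonglongrightarrow> lim (integral_approx 1 n)"
    unfolding integral_approx_1_binomial[symmetric] using convergentI convergent_LIMSEQ_iff by blast
  have 0: "integral_approx 0 n \<longlonglongrightarrow> lim (integral_approx 0 n)"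
    using convergent_integral_approx convergent_LIMSEQ_iff by blast
  have "(\<lambda>N. q * integral_approx 1 n N - integral_approx 0 n N)
      \<longlonglongrightarrow> q * lim (integral_approx 1 n) - lim (integral_approx 0 n)"
    by (intro tendsto_diff tendsto_mult tendsto_const 0 1)
  then have "boundary_term n \<longlonglongrightarrow> q * lim (integral_approx 1 n) - lim (integral_approx 0 n)"
    by (simp only: integral_approx_telescope[OF assms])
  then have "q * lim (integral_approx 1 n) - lim (integral_approx 0 n)
      = (if n = 1 then of_nat \<alpha> / geometric q \<alpha> else 0)"
    using tendsto_boundary_term[OF assms] LIMSEQ_unique by blast
  then show ?thesis
    using q_bernoulli_poly_eq_lim[of n 0] q_bernoulli_poly_eq_lim[of n 1] q_number_base_of_nat[of 1 \<alpha>]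
    by (simp add: q_bernoulli_number_def)
qed

end

end

theorem theorem6:
  fixes p \<alpha> :: nat and q :: "'a::nonarch_normed_field"
  assumes "is_padic_complex_field p TYPE('a)"
    and "prime p" and "odd p"
    and "padic_norm (1 - q) < real p powr (- 1 / (real p - 1))"
    and "\<alpha> \<ge> 1"
  shows "q_bernoulli_number p \<alpha> 0 q = 1 \<and>
    (\<forall>n\<ge>1. q * q_bernoulli_poly p \<alpha> n q 1 - q_bernoulli_number p \<alpha> n q =
       (if n = 1 then of_nat \<alpha> / q_number q (of_nat \<alpha>) else 0))"
proof -
  interpret padic_field p "TYPE('a)"
    using assms(1) by unfold_locales (auto simp: is_padic_complex_field_def)
  have "padic_norm (q - 1) < radius"
    using assms(4) by (simp add: radius_def padic_norm_minus_commute)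
  then show ?thesis
    using q_bernoulli_0 q_bernoulli_difference assms(5) by simp
qed

end
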